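(* Let $d,n\ge1$, $k\ge0$, and let $\Sigma\in\mathbb{R}^{d\times d}$ be positive definite. Let $x^{(1)},\dots,x^{(n+1)}$ be i.i.d. $\mathcal{N}(0,\Sigma)$, $w_\star\sim\mathcal{N}(0,\Sigma^{-1})$ independent, and $y^{(i)}=\langle x^{(i)},w_\star\rangle$ for $i\le n$. Let $$Z_0=\begin{bmatrix} x^{(1)} & \cdots & x^{(n)} & x^{(n+1)}\\ y^{(1)} & \cdots & y^{(n)} & 0\end{bmatrix},\qquad M=\begin{bmatrix} I_n & 0\\ 0& 0\end{bmatrix}\in\mathbb{R}^{(n+1)\times(n+1)}.$$ For $A=\{A_i\}_{i=0}^k$ with each $A_i\in\mathbb{R}^{d\times d}$ symmetric, set $P_i=\begin{bmatrix}0_{d\times d}&0\\0&1\end{bmatrix}$, $Q_i=\begin{bmatrix}A_i&0\\0&0\end{bmatrix}$, $Z_{i+1}=Z_i+\frac1nP_iZ_iM(Z_i^\top Q_iZ_i)$ for $i=0,\dots,k$, and $$f(A)=\mathbb{E}\Big[\big([Z_{k+1}]_{d+1,n+1}+w_\star^\top x^{(n+1)}\big)^2\Big].$$ Let $\mathcal{S}$ be the set of $A=\{A_i\}_{i=0}^k$ such that for every $i$ there is a scalar $a_i\in\mathbb{R}$ with $A_i=a_i\Sigma^{-1}$. Then $$\inf_{A\in\mathcal{S}}\sum_{i=0}^k\|\nabla_{A_i}f(A)\|_F^2=0,$$ where $\nabla_{A_i}f$ denotes the gradient of $f$ with respect to the matrix $A_i$ (with respect to the Frobenius inner product).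
   Context: $[X]_{i,j}$ denotes the $(i,j)$ entry of a matrix; $\|\cdot\|_F$ is the Frobenius norm. The expectation is over $x^{(1)},\dots,x^{(n+1)},w_\star$. *)

theory Defs
  imports "HOL-Probability.Probability"
begin

definition pos_def_mat :: "real^'d^'d \<Rightarrow> bool" where
  "pos_def_mat S \<longleftrightarrow> transpose S = S \<and> (\<forall>x. x \<noteq> 0 \<longrightarrow> x \<bullet> (S *v x) > 0)"

definition mvn_density :: "real^'d^'d \<Rightarrow> real^'d \<Rightarrow> real" where
  "mvn_density S x =
     exp (- (x \<bullet> (matrix_inv S *v x)) / 2) / sqrt ((2 * pi) ^ CARD('d) * det S)"

definition mvn :: "real^'d^'d \<Rightarrow> (real^'d) measure" where
  "mvn S = density lborel (\<lambda>x. ennreal (mvn_density S x))"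

definition mmul :: "'b set \<Rightarrow> ('a \<Rightarrow> 'b \<Rightarrow> real) \<Rightarrow> ('b \<Rightarrow> 'c \<Rightarrow> real) \<Rightarrow> 'a \<Rightarrow> 'c \<Rightarrow> real" where
  "mmul J A B = (\<lambda>r c. \<Sum>j\<in>J. A r j * B j c)"

definition mtrans :: "('a \<Rightarrow> 'b \<Rightarrow> real) \<Rightarrow> 'b \<Rightarrow> 'a \<Rightarrow> real" where
  "mtrans A = (\<lambda>r c. A c r)"

text \<open>Rows of the (d+1) x (n+1) matrix Z are indexed by 'd option (Some a = row a of the
  first d rows, None = row d+1); columns by 0..n (column j = column j+1 of the paper).\<close>

definition Z0 :: "nat \<Rightarrow> (nat \<Rightarrow> real^'d) \<Rightarrow> real^'d \<Rightarrow> 'd option \<Rightarrow> nat \<Rightarrow> real" where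
  "Z0 n X w = (\<lambda>r c. case r of Some a \<Rightarrow> X c $ a | None \<Rightarrow> (if c < n then X c \<bullet> w else 0))"

definition Mmat :: "nat \<Rightarrow> nat \<Rightarrow> nat \<Rightarrow> real" where
  "Mmat n = (\<lambda>r c. if r = c \<and> r < n then 1 else 0)"

definition Pmat :: "'d option \<Rightarrow> 'd option \<Rightarrow> real" where
  "Pmat = (\<lambda>r s. if r = None \<and> s = None then 1 else 0)"

definition Qmat :: "real^'d^'d \<Rightarrow> 'd option \<Rightarrow> 'd option \<Rightarrow> real" where
  "Qmat A = (\<lambda>r s. case (r, s) of (Some a, Some b) \<Rightarrow> A $ a $ b | _ \<Rightarrow> 0)"

definition layer :: "nat \<Rightarrow> real^'d^'d \<Rightarrow> ('d::finite option \<Rightarrow> nat \<Rightarrow> real) \<Rightarrow> 'd option \<Rightarrow> nat \<Rightarrow> real" where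
  "layer n A Z = (\<lambda>r c. Z r c + (1 / real n) *
      mmul {..n} (mmul {..n} (mmul UNIV Pmat Z) (Mmat n))
                 (mmul UNIV (mmul UNIV (mtrans Z) (Qmat A)) Z) r c)"

primrec Zit :: "nat \<Rightarrow> (nat \<Rightarrow> real^'d^'d) \<Rightarrow> (nat \<Rightarrow> real^'d) \<Rightarrow> real^'d \<Rightarrow> nat
                 \<Rightarrow> 'd::finite option \<Rightarrow> nat \<Rightarrow> real" where
  "Zit n A X w 0 = Z0 n X w"
| "Zit n A X w (Suc i) = layer n (A i) (Zit n A X w i)"

text \<open>Joint law of (x^(1),...,x^(n+1)) (stored as X 0, ..., X n) i.i.d. N(0,S), independent of
  w ~ N(0, S^{-1}).\<close>
definition data_measure :: "real^'d^'d \<Rightarrow> nat \<Rightarrow> ((nat \<Rightarrow> real^'d) \<times> (real^'d)) measure" where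
  "data_measure S n = (PiM {..n} (\<lambda>_. mvn S)) \<Otimes>\<^sub>M mvn (matrix_inv S)"

definition fobj :: "real^'d^'d \<Rightarrow> nat \<Rightarrow> nat \<Rightarrow> (nat \<Rightarrow> real^'d^'d) \<Rightarrow> real" where
  "fobj S n k A = (\<integral>p. (Zit n A (fst p) (snd p) (Suc k) None n + snd p \<bullet> fst p n)\<^sup>2
                     \<partial>data_measure S n)"

definition frob_grad :: "(real^'d^'d \<Rightarrow> real) \<Rightarrow> real^'d^'d \<Rightarrow> real^'d^'d" where
  "frob_grad g B = (SOME G. (g has_derivative (\<lambda>H. G \<bullet> H)) (at B))"

end

(*
  In coordinates whitened by S the problem is rotation invariant, so at A_i = a_i S^{-1} each
  gradient is a multiple of the identity. Without whitening: the reflections preserving S^{-1}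
  act on the matrices by A -> R^T A R, leave f unchanged and fix every multiple of S^{-1}; a gradient invariant
  under all of them is c S, hence is controlled by its pairing with S^{-1}, which is the partial
  derivative of F(a) = f(a_0 S^{-1}, ..., a_k S^{-1}). So it suffices to make the gradient of the
  nonnegative function F small, and a minimiser of F(a) + eps |a|^2 does this. Only finiteness of
  the Gaussian moments is used, never their values or the normalisation of the density.
*)
theory Submission
  imports Defs
begin

section \<open>Integrals of polynomial families\<close>

text \<open>The symmetries are restricted to involutions because such an \<open>R\<close> is its own
  inverse. The change of variables for \<open>w\<close> that preserves all pairings with the data is
  then \<open>transpose R\<close>, and the image of Lebesgue measure can be identified through
  uniqueness of translation-invariant measures. Reflections are involutions and still plentiful
  enough: one reflection for each direction \<open>u\<close>, tested on the matrices
  \<open>outer x u\<close> with \<open>x\<close> orthogonal to \<open>u\<close>, forces the scalar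
  form of the gradient. Regularity of f does not go through differentiation under the integral sign:
  the integrand is a finite sum of products of a function of the parameter and a random variable
  with all moments. The penalty is there because \<open>F\<close> is bounded below but is not shown
  to attain its infimum; it yields arbitrarily small gradients rather than a critical point.\<close>

definition all_moments :: "'a measure \<Rightarrow> ('a \<Rightarrow> real) \<Rightarrow> bool" where
  "all_moments M v \<longleftrightarrow> v \<in> borel_measurable M \<and> (\<forall>p::nat. integrable M (\<lambda>x. \<bar>v x\<bar> ^ p))"

lemma all_momentsD:
  assumes "all_moments M v"
  shows "v \<in> borel_measurable M" "integrable M (\<lambda>x. \<bar>v x\<bar> ^ p)" "integrable M v"
proof -
  show *: "v \<in> borel_measurable M" "integrable M (\<lambda>x. \<bar>v x\<bar> ^ p)" for p
    using assms by (auto simp: all_moments_def)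
  show "integrable M v"
    using *(2)[of 1] by (simp add: integrable_abs_iff[OF *(1)])
qed

text \<open>Closure under products is the reason for demanding every moment: arbitrary monomials in
  the Gaussian coordinates become integrable, whatever their dependence. The bound is
  \<open>2 * s * t\<close> at most \<open>s^2 + t^2\<close>, applied to p-th powers.\<close>

lemma all_moments_mult:
  assumes "all_moments M u" "all_moments M v"
  shows "all_moments M (\<lambda>x. u x * v x)"
  unfolding all_moments_def
proof (intro conjI allI)
  note [measurable] = all_momentsD(1)[OF assms(1)] all_momentsD(1)[OF assms(2)]
  show "(\<lambda>x. u x * v x) \<in> borel_measurable M" by measurable
  fix p :: nat
  show "integrable M (\<lambda>x. \<bar>u x * v x\<bar> ^ p)"
  proof (rule Bochner_Integration.integrable_bound)
    show "integrable M (\<lambda>x. \<bar>u x\<bar> ^ (p * 2) + \<bar>v x\<bar> ^ (p * 2))"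
      using assms by (intro Bochner_Integration.integrable_add all_momentsD(2))
    have "\<bar>a * b\<bar> ^ p \<le> \<bar>a\<bar> ^ (p * 2) + \<bar>b\<bar> ^ (p * 2)" for a b :: real
    proof -
      have "2 * (\<bar>a\<bar> ^ p * \<bar>b\<bar> ^ p) \<le> (\<bar>a\<bar> ^ p)\<^sup>2 + (\<bar>b\<bar> ^ p)\<^sup>2"
        using sum_squares_bound[of "\<bar>a\<bar> ^ p" "\<bar>b\<bar> ^ p"] by simp
      moreover have "0 \<le> \<bar>a\<bar> ^ p * \<bar>b\<bar> ^ p" by simp
      ultimately have "\<bar>a\<bar> ^ p * \<bar>b\<bar> ^ p \<le> (\<bar>a\<bar> ^ p)\<^sup>2 + (\<bar>b\<bar> ^ p)\<^sup>2" by linarith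
      then show ?thesis by (simp add: abs_mult power_mult_distrib power_mult)
    qed
    then show "AE x in M. norm (\<bar>u x * v x\<bar> ^ p) \<le> norm (\<bar>u x\<bar> ^ (p * 2) + \<bar>v x\<bar> ^ (p * 2))"
      by auto
  qed measurable
qed

lemma all_moments_const: "finite_measure M \<Longrightarrow> all_moments M (\<lambda>_. c)"
  by (auto simp: all_moments_def intro!: finite_measure.integrable_const)

text \<open>\<open>C\<close> is a class of coefficient functions closed under the ring operations; it is instantiated
  with continuity (in the scalars \<open>a\<^sub>i\<close>) and with differentiability (in a single matrix \<open>A\<^sub>i\<close>).\<close>
inductive separable :: "(('p \<Rightarrow> real) \<Rightarrow> bool) \<Rightarrow> 'a measure \<Rightarrow> ('p \<Rightarrow> 'a \<Rightarrow> real) \<Rightarrow> bool"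
  for C M where
  tensor: "C e \<Longrightarrow> all_moments M v \<Longrightarrow> separable C M (\<lambda>\<theta> x. e \<theta> * v x)"
| add: "separable C M g \<Longrightarrow> separable C M h \<Longrightarrow> separable C M (\<lambda>\<theta> x. g \<theta> x + h \<theta> x)"

locale coefficients =
  fixes C :: "('p \<Rightarrow> real) \<Rightarrow> bool" and M :: "'a measure"
  assumes C_const: "\<And>c. C (\<lambda>_. c)"
    and C_add: "\<And>e f. C e \<Longrightarrow> C f \<Longrightarrow> C (\<lambda>\<theta>. e \<theta> + f \<theta>)"
    and C_mult: "\<And>e f. C e \<Longrightarrow> C f \<Longrightarrow> C (\<lambda>\<theta>. e \<theta> * f \<theta>)"
    and finite_M: "finite_measure M"
begin

lemma separable_param: "C e \<Longrightarrow> separable C M (\<lambda>\<theta> x. e \<theta>)"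
  using separable.tensor[of C e M "\<lambda>_. 1"] all_moments_const[OF finite_M] by simp

lemma separable_data: "all_moments M v \<Longrightarrow> separable C M (\<lambda>\<theta>. v)"
  using separable.tensor[of C "\<lambda>_. 1" M v] C_const by simp

lemma separable_const: "separable C M (\<lambda>\<theta> x. c)"
  by (rule separable_param[OF C_const])

lemma separable_mult:
  assumes "separable C M g" "separable C M h"
  shows "separable C M (\<lambda>\<theta> x. g \<theta> x * h \<theta> x)"
  using assms(1)
proof induction
  case (tensor e v)
  from assms(2) show ?case
  proof induction
    case (tensor e' v')
    have "separable C M (\<lambda>\<theta> x. (e \<theta> * e' \<theta>) * (v x * v' x))"
      using tensor \<open>C e\<close> \<open>all_moments M v\<close>
      by (intro separable.tensor C_mult all_moments_mult)
    then show ?case by (simp add: ac_simps)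
  next
    case (add g h)
    then show ?case by (simp add: distrib_left separable.add)
  qed
next
  case (add g h)
  then show ?case by (simp add: distrib_right separable.add)
qed

lemma separable_sum:
  assumes "\<And>i. i \<in> I \<Longrightarrow> separable C M (h i)"
  shows "separable C M (\<lambda>\<theta> x. \<Sum>i\<in>I. h i \<theta> x)"
  using assms
  by (induction I rule: infinite_finite_induct) (auto intro: separable_const separable.add)

text \<open>On a tensor the integral is \<open>e\<close> times a number, so regularity in the
  parameter passes through the integral with no domination argument.\<close>

lemma separable_integral:
  assumes "separable C M h"
  shows "(\<forall>\<theta>. integrable M (h \<theta>)) \<and> C (\<lambda>\<theta>. \<integral>x. h \<theta> x \<partial>M)"
  using assms
proof induction
  case (tensor e v)
  then show ?case
    by (auto intro!: C_mult C_const all_momentsD(3))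
next
  case (add g h)
  then show ?case by (auto intro: C_add)
qed

end

section \<open>Positive definite matrices\<close>

lemma pos_def_mat_symD: "pos_def_mat S \<Longrightarrow> transpose S = S"
  and pos_def_mat_posD: "pos_def_mat S \<Longrightarrow> x \<noteq> 0 \<Longrightarrow> x \<bullet> (S *v x) > 0"
  by (auto simp: pos_def_mat_def)

lemma pos_def_mat_inverse:
  fixes S :: "real^'d^'d"
  assumes "pos_def_mat S"
  shows "matrix_inv S ** S = mat 1" "S ** matrix_inv S = mat 1" "pos_def_mat (matrix_inv S)"
    "matrix_inv (matrix_inv S) = S"
proof -
  have *: "matrix_inv B ** B = mat 1" "B ** matrix_inv B = mat 1" if "invertible B" for B :: "real^'d^'d"
    using that unfolding invertible_def matrix_inv_def by (metis (mono_tags, lifting) someI_ex)+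
  have "invertible S"
    unfolding invertible_left_inverse matrix_left_invertible_ker
    using pos_def_mat_posD[OF assms] by (metis inner_zero_right less_irrefl)
  note 1 = *(1)[OF this] and 2 = *(2)[OF this]
  show "matrix_inv S ** S = mat 1" "S ** matrix_inv S = mat 1" by fact+
  have "invertible (matrix_inv S)" using 1 2 unfolding invertible_def by blast
  from *(1)[OF this] show "matrix_inv (matrix_inv S) = S"
    by (metis 1 matrix_mul_assoc matrix_mul_lid matrix_mul_rid)
  have t: "transpose (matrix_inv S) = matrix_inv S"
    by (metis 1 2 matrix_mul_assoc matrix_mul_lid matrix_mul_rid matrix_transpose_mul
        pos_def_mat_symD[OF assms] transpose_mat)
  show "pos_def_mat (matrix_inv S)"
    unfolding pos_def_mat_def
  proof (intro conjI t allI impI)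
    fix x :: "real^'d" assume "x \<noteq> 0"
    define y where "y = matrix_inv S *v x"
    have x: "x = S *v y" by (simp add: y_def matrix_vector_mul_assoc 2)
    then have "y \<noteq> 0" using \<open>x \<noteq> 0\<close> by auto
    then show "0 < x \<bullet> (matrix_inv S *v x)"
      using pos_def_mat_posD[OF assms, of y] unfolding y_def[symmetric] x[symmetric] by (simp add: inner_commute)
  qed
qed

text \<open>The constant is the minimum of the quadratic form on the compact unit sphere;
  homogeneity of degree two does the rest. It later bounds Gaussian densities by radial
  ones.\<close>

lemma pos_def_mat_coercive:
  fixes S :: "real^'d^'d"
  assumes "pos_def_mat S"
  obtains m where "m > 0" "\<And>x. m * (norm x)\<^sup>2 \<le> x \<bullet> (S *v x)"
proof -
  have "continuous_on (sphere 0 1) (\<lambda>x::real^'d. x \<bullet> (S *v x))"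
    by (intro continuous_intros linear_continuous_on matrix_vector_mul_bounded_linear)
  moreover have "sphere 0 1 \<noteq> ({} :: (real^'d) set)"
    by (simp add: sphere_eq_empty)
  ultimately obtain z where z: "z \<in> sphere 0 1"
    "\<And>x::real^'d. x \<in> sphere 0 1 \<Longrightarrow> z \<bullet> (S *v z) \<le> x \<bullet> (S *v x)"
    using continuous_attains_inf[OF compact_sphere] by blast
  show thesis
  proof (rule that)
    show "z \<bullet> (S *v z) > 0"
      using z(1) by (intro pos_def_mat_posD[OF assms]) auto
    fix x :: "real^'d"
    show "z \<bullet> (S *v z) * (norm x)\<^sup>2 \<le> x \<bullet> (S *v x)"
    proof (cases "x = 0")
      case False
      have "z \<bullet> (S *v z) \<le> (x /\<^sub>R norm x) \<bullet> (S *v (x /\<^sub>R norm x))"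
        using False by (intro z(2)) auto
      also have "\<dots> = (x \<bullet> (S *v x)) / (norm x)\<^sup>2"
        by (simp add: matrix_vector_mult_scaleR power2_eq_square divide_inverse)
      finally show ?thesis using False by (simp add: field_simps)
    qed auto
  qed
qed

section \<open>Moments and symmetries of Gaussian measures\<close>

lemma integrable_exp_neg_norm_sq:
  fixes c :: real
  assumes "c > 0"
  shows "integrable lborel (\<lambda>x::'a::euclidean_space. exp (- c * (norm x)\<^sup>2))"
proof (rule integrableI_nonneg)
  \<comment> \<open>The standard deviation for which the one-dimensional normal density is
    proportional to \<open>exp (- c * x^2)\<close>; the integral over the whole space factors over
    the basis.\<close>
  define s where "s = sqrt (1 / (2 * c))"
  have s: "s > 0" "2 * s\<^sup>2 = 1 / c" using assms by (auto simp: s_def)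
  have "integrable lborel (\<lambda>x. sqrt (2 * pi * s\<^sup>2) * normal_density 0 s x)"
    using s by (intro integrable_mult_right integrable_normal_density)
  also have "(\<lambda>x. sqrt (2 * pi * s\<^sup>2) * normal_density 0 s x) = (\<lambda>x. exp (- c * x\<^sup>2))"
    using s assms by (auto simp: normal_density_def fun_eq_iff)
  finally have fin: "(\<integral>\<^sup>+x. ennreal (exp (- c * x\<^sup>2)) \<partial>lborel) < \<infinity>"
    by (simp add: integrable_iff_bounded)
  have norm_sq: "(norm x)\<^sup>2 = (\<Sum>b\<in>Basis. (x \<bullet> b)\<^sup>2)" for x :: 'a
    unfolding power2_norm_eq_inner by (subst euclidean_inner) (simp add: power2_eq_square)
  have "(\<integral>\<^sup>+(x::'a). ennreal (exp (- c * (norm x)\<^sup>2)) \<partial>lborel) =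
      (\<integral>\<^sup>+(x::'a). (\<Prod>b\<in>Basis. ennreal (exp (- c * (x \<bullet> b)\<^sup>2))) \<partial>lborel)"
    by (simp add: norm_sq prod_ennreal exp_sum[symmetric] sum_distrib_left sum_negf)
  also have "\<dots> = (\<Prod>b\<in>(Basis::'a set). \<integral>\<^sup>+x. ennreal (exp (- c * x\<^sup>2)) \<partial>lborel)"
    by (rule nn_integral_lborel_prod) auto
  also have "\<dots> < \<infinity>"
    using fin by (simp add: power_eq_top_ennreal less_top[symmetric])
  finally show "(\<integral>\<^sup>+(x::'a). ennreal (exp (- c * (norm x)\<^sup>2)) \<partial>lborel) < \<infinity>" .
qed auto

lemma power_le_fact_mult_exp:
  fixes y :: real
  assumes "y \<ge> 0"
  shows "y ^ p \<le> fact p * exp y"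
proof -
  have "(\<Sum>n\<in>{p}. y ^ n /\<^sub>R fact n) \<le> (\<Sum>n. y ^ n /\<^sub>R fact n)"
    using assms by (intro sum_le_suminf summable_exp_generic) auto
  then show ?thesis by (simp add: exp_def field_simps)
qed

text \<open>Half of the exponent absorbs the power, since \<open>(c * r^2) ^ p\<close> is at most
  \<open>fact p * exp (c * r^2)\<close>. The summand 1 covers small \<open>r\<close>.\<close>

lemma power_mult_exp_neg_le:
  fixes c r :: real
  assumes "c > 0"
  shows "\<bar>r\<bar> ^ p * exp (- (2 * c) * r\<^sup>2) \<le> (1 + fact p / c ^ p) * exp (- c * r\<^sup>2)"
proof -
  have "\<bar>r\<bar> ^ p \<le> 1 + (r\<^sup>2) ^ p"
  proof (cases "\<bar>r\<bar> \<le> 1")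
    case True
    then show ?thesis by (meson abs_ge_zero add_increasing2 power_le_one zero_le_power zero_le_power2)
  next
    case False
    then have "\<bar>r\<bar> ^ p \<le> \<bar>r\<bar> ^ (2 * p)" by (intro power_increasing) auto
    then show ?thesis by (simp add: power_mult)
  qed
  also have "\<dots> \<le> 1 + fact p / c ^ p * exp (c * r\<^sup>2)"
    using power_le_fact_mult_exp[of "c * r\<^sup>2" p] assms by (simp add: field_simps power_mult_distrib)
  also have "\<dots> \<le> (1 + fact p / c ^ p) * exp (c * r\<^sup>2)"
    using assms by (simp add: distrib_right)
  finally have "\<bar>r\<bar> ^ p * exp (- (2 * c) * r\<^sup>2)
      \<le> (1 + fact p / c ^ p) * exp (c * r\<^sup>2) * exp (- (2 * c) * r\<^sup>2)"
    by (intro mult_right_mono) auto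
  also have "\<dots> = (1 + fact p / c ^ p) * exp (- c * r\<^sup>2)"
    by (simp add: mult.assoc exp_add[symmetric])
  finally show ?thesis .
qed

text \<open>Two nonzero translation-invariant measures are proportional by Fubini, and the value of
  an even \<open>T\<close>-invariant weight fixes the factor.\<close>
lemma distr_lborel_linear_involution:
  fixes T :: "'a::euclidean_space \<Rightarrow> 'a" and g :: "'a \<Rightarrow> ennreal"
  assumes T: "linear T" "\<And>x. T (T x) = x"
    and g [measurable]: "g \<in> borel_measurable borel"
    and g_inv: "\<And>x. g (T x) = g x" "\<And>x. g (- x) = g x"
    and g_fin: "(\<integral>\<^sup>+x. g x \<partial>lborel) \<noteq> 0" "(\<integral>\<^sup>+x. g x \<partial>lborel) \<noteq> \<infinity>"
  shows "distr lborel lborel T = lborel"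
proof (rule measure_eqI)
  have [measurable]: "T \<in> borel_measurable borel"
    using T(1) by (intro borel_measurable_continuous_onI linear_continuous_on linear_conv_bounded_linear[THEN iffD1])
  define \<nu> where "\<nu> = distr lborel lborel T"
  have [measurable_cong]: "sets \<nu> = sets borel" by (simp add: \<nu>_def)
  have shift: "(\<integral>\<^sup>+x. h (c + x) \<partial>lborel) = (\<integral>\<^sup>+x. h x \<partial>lborel)"
    if [measurable]: "h \<in> borel_measurable borel" for h :: "'a \<Rightarrow> ennreal" and c
    by (subst (2) lborel_distr_plus[symmetric, of c]) (simp add: nn_integral_distr)
  have int_\<nu>: "(\<integral>\<^sup>+x. h x \<partial>\<nu>) = (\<integral>\<^sup>+x. h (T x) \<partial>lborel)"
    if [measurable]: "h \<in> borel_measurable borel" for h :: "'a \<Rightarrow> ennreal"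
    by (simp add: \<nu>_def nn_integral_distr)
  have shift_\<nu>: "(\<integral>\<^sup>+x. h (c + x) \<partial>\<nu>) = (\<integral>\<^sup>+x. h x \<partial>\<nu>)"
    if [measurable]: "h \<in> borel_measurable borel" for h :: "'a \<Rightarrow> ennreal" and c
    using shift[of "\<lambda>x. h (T x)" "T c"] by (simp add: int_\<nu> linear_add[OF T(1)] T(2))
  interpret L: sigma_finite_measure lborel by (rule sigma_finite_lborel)
  \<comment> \<open>Pushing \<open>\<nu>\<close> forward by \<open>T\<close> once more returns
    \<open>lborel\<close>, and sigma-finiteness of an image measure passes back to the original
    one.\<close>
  interpret \<nu>: sigma_finite_measure \<nu>
  proof (rule sigma_finite_measure_distr)
    have "distr \<nu> lborel T = lborel"
      by (simp add: \<nu>_def distr_distr comp_def T(2) distr_id2)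
    then show "sigma_finite_measure (distr \<nu> lborel T)" using sigma_finite_lborel by metis
  qed measurable
  interpret P: pair_sigma_finite lborel \<nu> ..
  fix B assume "B \<in> sets (distr lborel lborel T)"
  then have [measurable]: "B \<in> sets borel" by simp
  define f where "f = (indicator B :: 'a \<Rightarrow> ennreal)"
  have [measurable]: "f \<in> borel_measurable borel" by (simp add: f_def)
  \<comment> \<open>The kernel \<open>g y * f (y + x)\<close> is integrated in both orders.
    Translating \<open>x\<close> under \<open>\<nu>\<close> splits off \<open>f\<close>; translating
    \<open>y\<close> under \<open>lborel\<close>, and then \<open>x\<close> under
    \<open>\<nu>\<close>, splits off \<open>g\<close>, whose evenness provides the form
    \<open>g (- y + x)\<close>. By \<open>T\<close>-invariance \<open>g\<close> has the same
    integral for both measures, so that factor cancels.\<close>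
  have "(\<integral>\<^sup>+y. g y \<partial>lborel) * (\<integral>\<^sup>+x. f x \<partial>\<nu>) = (\<integral>\<^sup>+y. \<integral>\<^sup>+x. g y * f (y + x) \<partial>\<nu> \<partial>lborel)"
    by (simp add: nn_integral_cmult nn_integral_multc shift_\<nu>)
  also have "\<dots> = (\<integral>\<^sup>+x. \<integral>\<^sup>+y. g y * f (y + x) \<partial>lborel \<partial>\<nu>)"
    by (rule P.Fubini'[symmetric]) measurable
  also have "\<dots> = (\<integral>\<^sup>+x. \<integral>\<^sup>+y. g (y - x) * f y \<partial>lborel \<partial>\<nu>)"
    using shift[of "\<lambda>y. g (y - x) * f y" x for x] by (simp add: add.commute)
  also have "\<dots> = (\<integral>\<^sup>+y. \<integral>\<^sup>+x. g (y - x) * f y \<partial>\<nu> \<partial>lborel)"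
    by (rule P.Fubini') measurable
  also have "\<dots> = (\<integral>\<^sup>+y. \<integral>\<^sup>+x. g (- y + x) * f y \<partial>\<nu> \<partial>lborel)"
    using g_inv(2)[of "y - x" for x y] by simp
  also have "\<dots> = (\<integral>\<^sup>+x. g x \<partial>\<nu>) * (\<integral>\<^sup>+y. f y \<partial>lborel)"
    using shift_\<nu>[OF g, of "- y" for y] by (simp add: nn_integral_cmult nn_integral_multc)
  finally have "(\<integral>\<^sup>+y. g y \<partial>lborel) * emeasure \<nu> B = (\<integral>\<^sup>+y. g y \<partial>lborel) * emeasure lborel B"
    by (simp add: int_\<nu> g_inv f_def)
  then show "emeasure (distr lborel lborel T) B = emeasure lborel B"
    using g_fin by (simp add: \<nu>_def ennreal_mult_cancel_left)
qed simp

lemma borel_measurable_mvn_density [measurable]: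
  "mvn_density S \<in> borel_measurable borel"
  unfolding mvn_density_def divide_inverse
  by (intro borel_measurable_times borel_measurable_const borel_measurable_continuous_onI
      continuous_intros linear_continuous_on matrix_vector_mul_bounded_linear)

lemma sets_mvn [measurable_cong, simp]: "sets (mvn S) = sets borel"
  and space_mvn [simp]: "space (mvn S) = UNIV"
  by (simp_all add: mvn_def)

text \<open>The hypothesis concerns the matrix in the exponent of the density, so the lemma serves
  both the law of the data and, as \<open>matrix_inv\<close> is undone by itself, that of
  \<open>w\<close>.\<close>

lemma mvn_moment_finite:
  fixes S :: "real^'d^'d"
  assumes "pos_def_mat (matrix_inv S)"
  shows "(\<integral>\<^sup>+x. ennreal (\<bar>x $ a\<bar> ^ p) \<partial>mvn S) < \<infinity>"
proof -
  obtain m where m: "m > 0" "\<And>x. m * (norm x)\<^sup>2 \<le> x \<bullet> (matrix_inv S *v x)"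
    using pos_def_mat_coercive[OF assms] by blast
  \<comment> \<open>The exponent carries a factor 1/2 and half of what remains is spent on the power
    of \<open>x\<close>, hence the quarter.\<close>
  define c where "c = m / 4"
  have c: "c > 0" "\<And>x. 4 * c * (norm x)\<^sup>2 \<le> x \<bullet> (matrix_inv S *v x)"
    using m by (auto simp: c_def)
  define K where "K = inverse \<bar>sqrt ((2 * pi) ^ CARD('d) * det S)\<bar>"
  define D where "D = K * (1 + fact p / c ^ p)"
  have le: "mvn_density S x * \<bar>x $ a\<bar> ^ p \<le> D * exp (- c * (norm x)\<^sup>2)" for x
  proof -
    have "mvn_density S x \<le> \<bar>mvn_density S x\<bar>" by simp
    also have "\<dots> = K * exp (- (x \<bullet> (matrix_inv S *v x)) / 2)"
      by (simp only: mvn_density_def K_def divide_inverse[of _ "sqrt x" for x] abs_mult abs_inverse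
          abs_exp_cancel mult.commute)
    also have "\<dots> \<le> K * exp (- (2 * c) * (norm x)\<^sup>2)"
      using c(2)[of x] by (intro mult_left_mono) (auto simp: K_def)
    finally have "mvn_density S x * \<bar>x $ a\<bar> ^ p
        \<le> K * exp (- (2 * c) * (norm x)\<^sup>2) * \<bar>norm x\<bar> ^ p"
      using component_le_norm_cart[of x a] by (intro mult_mono power_mono) (auto simp: K_def)
    also have "\<dots> = K * (\<bar>norm x\<bar> ^ p * exp (- (2 * c) * (norm x)\<^sup>2))" by simp
    also have "\<dots> \<le> K * ((1 + fact p / c ^ p) * exp (- c * (norm x)\<^sup>2))"
      using c(1) by (intro mult_left_mono power_mult_exp_neg_le) (auto simp: K_def)
    finally show ?thesis by (simp add: D_def)
  qed
  have "(\<integral>\<^sup>+x. ennreal (\<bar>x $ a\<bar> ^ p) \<partial>mvn S)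
      = (\<integral>\<^sup>+x. ennreal (mvn_density S x * \<bar>x $ a\<bar> ^ p) \<partial>lborel)"
    by (simp add: mvn_def nn_integral_density ennreal_mult'')
  also have "\<dots> \<le> (\<integral>\<^sup>+(x::real^'d). ennreal (D * exp (- c * (norm x)\<^sup>2)) \<partial>lborel)"
    by (rule nn_integral_mono, rule ennreal_leI, rule le)
  also have "\<dots> < \<infinity>"
  proof -
    have "integrable lborel (\<lambda>x::real^'d. D * exp (- c * (norm x)\<^sup>2))"
      by (intro integrable_mult_right integrable_exp_neg_norm_sq c(1))
    then have "(\<integral>\<^sup>+(x::real^'d). ennreal (norm (D * exp (- c * (norm x)\<^sup>2))) \<partial>lborel) < \<infinity>"
      unfolding integrable_iff_bounded by blast
    moreover have "D \<ge> 0" using c(1) by (simp add: D_def K_def)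
    ultimately show ?thesis by (simp only: real_norm_def abs_of_nonneg exp_ge_zero mult_nonneg_nonneg)
  qed
  finally show ?thesis .
qed

lemma finite_measure_mvn:
  assumes "pos_def_mat (matrix_inv S)"
  shows "finite_measure (mvn S)"
proof (rule finite_measureI)
  have "(\<integral>\<^sup>+x. 1 \<partial>mvn S) < \<infinity>"
    using mvn_moment_finite[OF assms, where p = 0] by simp
  then show "emeasure (mvn S) (space (mvn S)) \<noteq> \<infinity>" by simp
qed

lemma all_moments_mvn:
  assumes "pos_def_mat (matrix_inv S)"
  shows "all_moments (mvn S) (\<lambda>x. x $ a)"
  unfolding all_moments_def
proof (intro conjI allI)
  show [measurable]: "(\<lambda>x. x $ a) \<in> borel_measurable (mvn S)" by simp
  fix p
  show "integrable (mvn S) (\<lambda>x. \<bar>x $ a\<bar> ^ p)"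
  proof (rule integrableI_nonneg)
    show "(\<integral>\<^sup>+x. ennreal (\<bar>x $ a\<bar> ^ p) \<partial>mvn S) < \<infinity>" by (rule mvn_moment_finite[OF assms])
  qed auto
qed

text \<open>The unnormalised Gaussian weight is even, \<open>T\<close>-invariant and of positive
  finite integral, so it is the weight that makes \<open>T\<close> preserve Lebesgue measure; the
  density being invariant too, the Gaussian measure is preserved.\<close>

lemma distr_mvn_linear_involution:
  fixes S :: "real^'d^'d" and T :: "real^'d \<Rightarrow> real^'d"
  assumes "pos_def_mat (matrix_inv S)"
    and T: "linear T" "\<And>x. T (T x) = x"
    and inv: "\<And>x. T x \<bullet> (matrix_inv S *v T x) = x \<bullet> (matrix_inv S *v x)"
  shows "distr (mvn S) (mvn S) T = mvn S"
proof -
  let ?g = "\<lambda>x. exp (- (x \<bullet> (matrix_inv S *v x)) / 2)"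
  have [measurable]: "T \<in> borel_measurable borel"
    using T(1) by (intro borel_measurable_continuous_onI linear_continuous_on linear_conv_bounded_linear[THEN iffD1])
  have g[measurable]: "?g \<in> borel_measurable borel"
    unfolding divide_inverse
    by (intro borel_measurable_continuous_onI continuous_intros linear_continuous_on matrix_vector_mul_bounded_linear)
  obtain m where m: "m > 0" "\<And>x. m * (norm x)\<^sup>2 \<le> x \<bullet> (matrix_inv S *v x)"
    using pos_def_mat_coercive[OF assms(1)] by blast
  have "integrable lborel ?g"
  proof (rule Bochner_Integration.integrable_bound)
    show "integrable lborel (\<lambda>x::real^'d. exp (- (m / 2) * (norm x)\<^sup>2))"
      using m(1) by (intro integrable_exp_neg_norm_sq) simp
    show "?g \<in> borel_measurable lborel" using g by simp
    show "AE x in lborel. norm (?g x) \<le> norm (exp (- (m / 2) * (norm x)\<^sup>2))"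
      using m(2) by simp
  qed
  then have fin: "(\<integral>\<^sup>+x. ennreal (?g x) \<partial>lborel) \<noteq> \<infinity>"
    unfolding integrable_iff_bounded real_norm_def abs_exp_cancel by (auto simp: less_top)
  have nonzero: "(\<integral>\<^sup>+x. ennreal (?g x) \<partial>lborel) \<noteq> 0"
  proof
    assume "(\<integral>\<^sup>+x. ennreal (?g x) \<partial>lborel) = 0"
    moreover have "(\<lambda>x. ennreal (?g x)) \<in> borel_measurable lborel" using g by simp
    ultimately have "AE x in lborel. ennreal (?g x) = 0"
      by (simp only: nn_integral_0_iff_AE)
    moreover have "ennreal (?g x) \<noteq> 0" for x by simp
    ultimately have "AE x in (lborel :: (real^'d) measure). False" by (simp only: simp_thms)
    then show False by (simp add: trivial_limit_def[symmetric] ae_filter_eq_bot_iff)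
  qed
  have L: "distr lborel lborel T = lborel"
  proof (rule distr_lborel_linear_involution[OF T _ _ _ nonzero fin])
    show "(\<lambda>x. ennreal (?g x)) \<in> borel_measurable borel" using g by simp
    show "ennreal (?g (T x)) = ennreal (?g x)" for x by (simp only: inv)
    have "- x \<bullet> (matrix_inv S *v - x) = x \<bullet> (matrix_inv S *v x)" for x
      by (simp add: linear_neg[OF matrix_vector_mul_linear])
    then show "ennreal (?g (- x)) = ennreal (?g x)" for x by (simp only:)
  qed
  have "mvn S = density (distr lborel lborel T) (\<lambda>x. ennreal (mvn_density S x))"
    by (simp add: L mvn_def)
  also have "\<dots> = distr (density lborel (\<lambda>x. ennreal (mvn_density S (T x)))) lborel T"
    by (rule density_distr) auto
  also have "\<dots> = distr (mvn S) (mvn S) T"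
    by (intro distr_cong) (simp_all add: mvn_def mvn_density_def inv)
  finally show ?thesis ..
qed

section \<open>Moments and invariance for product measures\<close>

lemma all_moments_PiM_component:
  fixes M :: "'i \<Rightarrow> 'a measure"
  assumes I: "finite I" "c \<in> I" and fin: "\<And>i. finite_measure (M i)"
    and v: "all_moments (M c) v"
  shows "all_moments (PiM I M) (\<lambda>x. v (x c))"
  unfolding all_moments_def
proof (intro conjI allI)
  interpret finite_measure "M i" for i by (rule fin)
  interpret product_sigma_finite M ..
  show "(\<lambda>x. v (x c)) \<in> borel_measurable (PiM I M)"
    using I all_momentsD(1)[OF v] by measurable
  fix p :: nat
  \<comment> \<open>The coordinate function is written as a product with factor 1 in all other
    coordinates; 1 is integrable because the factors are finite measures.\<close>
  have "integrable (PiM I M) (\<lambda>x. \<Prod>i\<in>I. (if i = c then \<lambda>y. \<bar>v y\<bar> ^ p else (\<lambda>_. 1)) (x i))"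
    using I(1) all_momentsD(2)[OF v] by (intro product_integrable_prod) auto
  moreover have "(\<Prod>i\<in>I. (if i = c then \<lambda>y. \<bar>v y\<bar> ^ p else (\<lambda>_. 1)) (x i)) = \<bar>v (x c)\<bar> ^ p" for x
    using I by (simp add: if_distribR prod.delta)
  ultimately show "integrable (PiM I M) (\<lambda>x. \<bar>v (x c)\<bar> ^ p)" by simp
qed

lemma finite_measure_PiM_finite:
  assumes I: "finite I" and fin: "\<And>i. finite_measure (M i)"
  shows "finite_measure (PiM I M)"
proof (rule finite_measureI)
  interpret finite_measure "M i" for i by (rule fin)
  interpret product_sigma_finite M ..
  have "emeasure (PiM I M) (Pi\<^sub>E I (\<lambda>i. space (M i))) = (\<Prod>i\<in>I. emeasure (M i) (space (M i)))"
    by (rule emeasure_PiM[OF I]) auto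
  also have "\<dots> \<noteq> \<infinity>"
    using emeasure_finite by (simp add: ennreal_prod_eq_top I)
  finally show "emeasure (PiM I M) (space (PiM I M)) \<noteq> \<infinity>"
    by (simp add: space_PiM)
qed

lemma finite_measure_pair:
  assumes "finite_measure M" "finite_measure N"
  shows "finite_measure (M \<Otimes>\<^sub>M N)"
proof (rule finite_measureI)
  interpret M: finite_measure M by fact
  interpret N: finite_measure N by fact
  have "emeasure (M \<Otimes>\<^sub>M N) (space M \<times> space N) = emeasure M (space M) * emeasure N (space N)"
    by (rule N.emeasure_pair_measure_Times) auto
  then show "emeasure (M \<Otimes>\<^sub>M N) (space (M \<Otimes>\<^sub>M N)) \<noteq> \<infinity>"
    by (simp add: space_pair_measure ennreal_mult_eq_top_iff)
qed

lemma all_moments_fst: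
  assumes "finite_measure M" "finite_measure N" and v: "all_moments M v"
  shows "all_moments (M \<Otimes>\<^sub>M N) (\<lambda>p. v (fst p))"
  unfolding all_moments_def
proof (intro conjI allI)
  interpret M: finite_measure M by fact
  interpret N: finite_measure N by fact
  interpret pair_sigma_finite M N ..
  note [measurable] = all_momentsD(1)[OF v]
  show "(\<lambda>p. v (fst p)) \<in> borel_measurable (M \<Otimes>\<^sub>M N)" by measurable
  show "integrable (M \<Otimes>\<^sub>M N) (\<lambda>q. \<bar>v (fst q)\<bar> ^ p)" for p
    using all_momentsD(2)[OF v] by (intro Fubini_integrable) simp_all
qed

lemma all_moments_snd:
  assumes "finite_measure M" "finite_measure N" and v: "all_moments N v"
  shows "all_moments (M \<Otimes>\<^sub>M N) (\<lambda>p. v (snd p))"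
  unfolding all_moments_def
proof (intro conjI allI)
  interpret M: finite_measure M by fact
  interpret N: finite_measure N by fact
  interpret pair_sigma_finite M N ..
  note [measurable] = all_momentsD(1)[OF v]
  show "(\<lambda>p. v (snd p)) \<in> borel_measurable (M \<Otimes>\<^sub>M N)" by measurable
  show "integrable (M \<Otimes>\<^sub>M N) (\<lambda>q. \<bar>v (snd q)\<bar> ^ p)" for p
    using all_momentsD(2)[OF v] by (intro Fubini_integrable) simp_all
qed

text \<open>The two measures agree on boxes, which determine them. Restricting the map to
  \<open>I\<close> keeps its values in the extensional function space underlying
  \<open>PiM\<close>.\<close>

lemma distr_PiM_invariant:
  assumes I: "finite I" and fin: "\<And>i. finite_measure (M i)"
    and T: "T \<in> measurable N N" and M: "\<And>i. i \<in> I \<Longrightarrow> M i = N" and inv: "distr N N T = N"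
  shows "distr (PiM I M) (PiM I M) (\<lambda>x. \<lambda>i\<in>I. T (x i)) = PiM I M"
proof -
  interpret finite_measure "M i" for i by (rule fin)
  interpret product_sigma_finite M ..
  have T': "T \<in> measurable (M i) (M i)" if "i \<in> I" for i using T M[OF that] by simp
  then have meas: "(\<lambda>x. \<lambda>i\<in>I. T (x i)) \<in> measurable (PiM I M) (PiM I M)"
    by (intro measurable_restrict measurable_compose[OF measurable_component_singleton])
  show ?thesis
  proof (rule PiM_eqI[OF I])
    fix A assume A: "\<And>i. i \<in> I \<Longrightarrow> A i \<in> sets (M i)"
    let ?B = "\<lambda>i. T -` A i \<inter> space (M i)"
    have B: "?B i \<in> sets (M i)" if "i \<in> I" for i
      using measurable_sets[OF T'[OF that] A[OF that]] .
    have "emeasure (distr (PiM I M) (PiM I M) (\<lambda>x. \<lambda>i\<in>I. T (x i))) (Pi\<^sub>E I A)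
        = emeasure (PiM I M) ((\<lambda>x. \<lambda>i\<in>I. T (x i)) -` Pi\<^sub>E I A \<inter> space (PiM I M))"
      using A I by (intro emeasure_distr[OF meas] sets_PiM_I_finite) auto
    also have "(\<lambda>x. \<lambda>i\<in>I. T (x i)) -` Pi\<^sub>E I A \<inter> space (PiM I M) = Pi\<^sub>E I ?B"
      by (auto simp: space_PiM PiE_iff)
    also have "emeasure (PiM I M) (Pi\<^sub>E I ?B) = (\<Prod>i\<in>I. emeasure (M i) (?B i))"
      by (rule emeasure_PiM[OF I B])
    also have "\<dots> = (\<Prod>i\<in>I. emeasure (M i) (A i))"
    proof (rule prod.cong[OF refl])
      fix i assume i: "i \<in> I"
      have "emeasure (distr N N T) (A i) = emeasure N (T -` A i \<inter> space N)"
        using A[OF i] M[OF i] T by (intro emeasure_distr) auto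
      then show "emeasure (M i) (?B i) = emeasure (M i) (A i)"
        by (simp add: inv M[OF i])
    qed
    finally show "emeasure (distr (PiM I M) (PiM I M) (\<lambda>x. \<lambda>i\<in>I. T (x i))) (Pi\<^sub>E I A)
        = (\<Prod>i\<in>I. emeasure (M i) (A i))" .
  qed simp
qed

section \<open>The objective\<close>

context
  fixes S :: "real^'d^'d"
  assumes S: "pos_def_mat S"
begin

lemma pos_def_inv_inv: "pos_def_mat (matrix_inv (matrix_inv S))"
  using pos_def_mat_inverse(4)[OF S] S by simp

lemma finite_measure_data: "finite_measure (data_measure S n)"
  unfolding data_measure_def
  by (intro finite_measure_pair finite_measure_PiM_finite finite_measure_mvn pos_def_inv_inv
      pos_def_mat_inverse(3)[OF S] finite_atMost)

lemma all_moments_data_fst: "c \<le> n \<Longrightarrow> all_moments (data_measure S n) (\<lambda>p. fst p c $ a)"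
  unfolding data_measure_def
  by (rule all_moments_fst[where v = "\<lambda>x. x c $ a"])
     (auto intro!: finite_measure_PiM_finite finite_measure_mvn all_moments_mvn pos_def_inv_inv
      pos_def_mat_inverse(3)[OF S] all_moments_PiM_component[where v = "\<lambda>x. x $ a"])

lemma all_moments_data_snd: "all_moments (data_measure S n) (\<lambda>p. snd p $ a)"
  unfolding data_measure_def
  by (rule all_moments_snd[where v = "\<lambda>x. x $ a"])
     (auto intro!: finite_measure_PiM_finite finite_measure_mvn all_moments_mvn pos_def_inv_inv
      pos_def_mat_inverse(3)[OF S])

text \<open>The entries are polynomials in the data and in the entries of the parameter matrices.
  The bound \<open>c \<le> n\<close> keeps to coordinates that belong to the product
  measure.\<close>

lemma separable_Zit:
  fixes A :: "'p \<Rightarrow> nat \<Rightarrow> real^'d^'d"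
  assumes "coefficients C (data_measure S n)"
    and A: "\<And>i a b. C (\<lambda>\<theta>. A \<theta> i $ a $ b)"
  shows "c \<le> n \<Longrightarrow> separable C (data_measure S n) (\<lambda>\<theta> p. Zit n (A \<theta>) (fst p) (snd p) i r c)"
proof (induction i arbitrary: r c)
  interpret coefficients C "data_measure S n" by fact
  case 0
  show ?case
  proof (cases r)
    case None
    show ?thesis
    proof (cases "c < n")
      case True
      have "separable C (data_measure S n) (\<lambda>\<theta> p. \<Sum>a\<in>UNIV. fst p c $ a * snd p $ a)"
        using 0 by (intro separable_sum separable_mult separable_data all_moments_data_fst all_moments_data_snd)
      then show ?thesis using None True by (simp add: Z0_def inner_vec_def)
    qed (use None in \<open>simp add: Z0_def separable_const\<close>)
  next
    case (Some a)
    then show ?thesis using 0 by (simp add: Z0_def separable_data all_moments_data_fst)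
  qed
next
  interpret coefficients C "data_measure S n" by fact
  case (Suc i)
  have Q: "separable C (data_measure S n) (\<lambda>\<theta> p. Qmat (A \<theta> i) r s)" for r s
    by (cases r; cases s) (auto simp: Qmat_def intro: separable_const separable_param A)
  show ?case
    unfolding Zit.simps layer_def mmul_def mtrans_def
    by (intro separable.add separable_mult separable_sum separable_const Q Suc) auto
qed

text \<open>Leaving \<open>C\<close> abstract gives continuity and differentiability from one
  argument. The measurability claim is for the change of variables under the symmetries.\<close>

lemma coefficient_fobj:
  fixes A :: "'p \<Rightarrow> nat \<Rightarrow> real^'d^'d"
  assumes "coefficients C (data_measure S n)"
    and A: "\<And>i a b. C (\<lambda>\<theta>. A \<theta> i $ a $ b)"
  shows "C (\<lambda>\<theta>. fobj S n k (A \<theta>))"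
    "(\<lambda>p. (Zit n (A \<theta>) (fst p) (snd p) (Suc k) None n + snd p \<bullet> fst p n)\<^sup>2)
       \<in> borel_measurable (data_measure S n)"
proof -
  interpret coefficients C "data_measure S n" by fact
  have "separable C (data_measure S n)
      (\<lambda>\<theta> p. Zit n (A \<theta>) (fst p) (snd p) (Suc k) None n + (\<Sum>a\<in>UNIV. snd p $ a * fst p n $ a))"
    by (intro separable.add separable_sum separable_mult separable_data all_moments_data_fst
        all_moments_data_snd separable_Zit assms) auto
  then have *: "separable C (data_measure S n)
      (\<lambda>\<theta> p. (Zit n (A \<theta>) (fst p) (snd p) (Suc k) None n + snd p \<bullet> fst p n)\<^sup>2)"
    unfolding power2_eq_square inner_vec_def inner_real_def by (intro separable_mult)
  show "C (\<lambda>\<theta>. fobj S n k (A \<theta>))"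
    using separable_integral[OF *] unfolding fobj_def by blast
  show "(\<lambda>p. (Zit n (A \<theta>) (fst p) (snd p) (Suc k) None n + snd p \<bullet> fst p n)\<^sup>2)
       \<in> borel_measurable (data_measure S n)"
    using separable_integral[OF *] by blast
qed

end

section \<open>The recursion for the last row and its symmetries\<close>

lemma Zit_Some: "Zit n A X w i (Some a) c = X c $ a"
  by (induction i) (simp_all add: Z0_def layer_def mmul_def Pmat_def)

lemma sum_option: "(\<Sum>s\<in>UNIV. h s) = h None + (\<Sum>a\<in>UNIV. h (Some a))"
  for h :: "'a::finite option \<Rightarrow> 'b::comm_monoid_add"
  by (simp add: UNIV_option_conv sum.reindex)

text \<open>Only the last row evolves, as \<open>Pmat\<close> kills the update elsewhere, and the
  mask drops the query column, whence the sum over \<open>j<n\<close>. The data now enter only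
  through pairings \<open>X j \<bullet> (A i *v X c)\<close> and the initial
  \<open>X c \<bullet> w\<close>, which makes the equivariance visible.\<close>

lemma Zit_None_Suc:
  "Zit n A X w (Suc i) None c = Zit n A X w i None c
     + (1 / real n) * (\<Sum>j<n. Zit n A X w i None j * (X j \<bullet> (A i *v X c)))"
proof -
  have 1: "mmul {..n} (mmul UNIV Pmat (Zit n A X w i)) (Mmat n) None j
      = (if j < n then Zit n A X w i None j else 0)" for j
  proof -
    have "mmul {..n} (mmul UNIV Pmat (Zit n A X w i)) (Mmat n) None j
      = (\<Sum>l\<le>n. if l = j then (if j < n then Zit n A X w i None j else 0) else 0)"
      unfolding mmul_def by (intro sum.cong) (auto simp: sum_option Pmat_def Mmat_def)
    then show ?thesis by (simp add: sum.delta)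
  qed
  have 2: "mmul UNIV (mmul UNIV (mtrans (Zit n A X w i)) (Qmat (A i))) (Zit n A X w i) j c
      = X j \<bullet> (A i *v X c)" for j
  proof -
    have "mmul UNIV (mmul UNIV (mtrans (Zit n A X w i)) (Qmat (A i))) (Zit n A X w i) j c
      = (\<Sum>b\<in>UNIV. \<Sum>a\<in>UNIV. X j $ a * A i $ a $ b * X c $ b)"
      by (simp add: mmul_def mtrans_def sum_option Qmat_def Zit_Some sum_distrib_right)
    also have "\<dots> = (\<Sum>a\<in>UNIV. \<Sum>b\<in>UNIV. X j $ a * A i $ a $ b * X c $ b)"
      by (rule sum.swap)
    also have "\<dots> = X j \<bullet> (A i *v X c)"
      by (simp add: inner_vec_def matrix_vector_mult_def sum_distrib_left mult.assoc)
    finally show ?thesis .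
  qed
  have "mmul {..n} (mmul {..n} (mmul UNIV Pmat (Zit n A X w i)) (Mmat n))
          (mmul UNIV (mmul UNIV (mtrans (Zit n A X w i)) (Qmat (A i))) (Zit n A X w i)) None c
      = (\<Sum>j\<le>n. if j < n then Zit n A X w i None j * (X j \<bullet> (A i *v X c)) else 0)"
    unfolding mmul_def[of "{..n}" "mmul {..n} _ _"] 1 2 by (intro sum.cong) auto
  also have "\<dots> = (\<Sum>j<n. Zit n A X w i None j * (X j \<bullet> (A i *v X c)))"
    by (intro sum.mono_neutral_cong_right) auto
  finally show ?thesis by (simp add: layer_def)
qed

lemma Zit_None_equivariant:
  assumes X': "\<And>c. c \<le> n \<Longrightarrow> X' c = T (X c)"
    and A: "\<And>i x y. T x \<bullet> (A i *v T y) = x \<bullet> (A' i *v y)"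
    and w: "\<And>x. T x \<bullet> w' = x \<bullet> w"
  shows "c \<le> n \<Longrightarrow> Zit n A X' w' i None c = Zit n A' X w i None c"
proof (induction i arbitrary: c)
  case 0
  then show ?case by (simp add: Z0_def X' w)
next
  case (Suc i)
  have "(\<Sum>j<n. Zit n A X' w' i None j * (X' j \<bullet> (A i *v X' c)))
      = (\<Sum>j<n. Zit n A' X w i None j * (X j \<bullet> (A' i *v X c)))"
    using Suc by (intro sum.cong) (auto simp: X' A)
  then show ?case using Suc by (simp only: Zit_None_Suc)
qed

lemma inner_transpose_mult: "x \<bullet> (transpose R *v y) = (R *v x) \<bullet> y" for R :: "real^'n^'m"
  by (metis dot_lmul_matrix inner_commute transpose_matrix_vector)

text \<open>Inverting the isometry identity turns \<open>R\<close> into its inverse, which is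
  \<open>R\<close> again. This is the invariance needed for \<open>w\<close>, whose density has
  \<open>S\<close> in the exponent.\<close>

lemma involution_isometry_inverse:
  fixes S R :: "real^'d^'d"
  assumes S: "pos_def_mat S" and R: "R ** R = mat 1"
    and iso: "transpose R ** matrix_inv S ** R = matrix_inv S"
  shows "R ** S ** transpose R = S"
proof -
  note S' = pos_def_mat_inverse[OF S]
  have "transpose R ** matrix_inv S = matrix_inv S ** R"
    using iso R by (metis matrix_mul_assoc matrix_mul_rid)
  then have "S ** transpose R = R ** S"
    using S'(1,2) by (metis matrix_mul_assoc matrix_mul_lid matrix_mul_rid)
  then show ?thesis
    using R by (metis matrix_mul_assoc matrix_mul_lid)
qed

text \<open>Substitute \<open>R *v x\<close> for each data vector and
  \<open>transpose R *v w\<close> for \<open>w\<close>. The laws are preserved, and so are the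
  labels, because \<open>R ** R = mat 1\<close> gives
  \<open>(R *v x) \<bullet> (transpose R *v w) = x \<bullet> w\<close>; what changes is that each
  \<open>A i\<close> is conjugated.\<close>

lemma fobj_conjugate:
  fixes S R :: "real^'d^'d"
  assumes S: "pos_def_mat S" and R: "R ** R = mat 1"
    and iso: "transpose R ** matrix_inv S ** R = matrix_inv S"
  shows "fobj S n k (\<lambda>i. transpose R ** A i ** R) = fobj S n k A"
proof -
  note S' = pos_def_mat_inverse[OF S]
  define U where "U = transpose R"
  let ?T = "\<lambda>x. R *v x" and ?U = "\<lambda>x. U *v x"
  let ?D = "data_measure S n"
  let ?\<Phi> = "\<lambda>(X, w). (\<lambda>c\<in>{..n}. ?T (X c), ?U w)"
  let ?h = "\<lambda>A p. (Zit n A (fst p) (snd p) (Suc k) None n + snd p \<bullet> fst p n)\<^sup>2"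
  have R': "U ** U = mat 1"
    using R unfolding U_def by (metis matrix_transpose_mul transpose_mat)
  have conj: "(M *v x) \<bullet> (N *v (M *v y)) = x \<bullet> ((transpose M ** N ** M) *v y)"
    for M N :: "real^'d^'d" and x y
    by (simp only: matrix_vector_mul_assoc[symmetric] inner_transpose_mult)
  have T: "distr (mvn S) (mvn S) ?T = mvn S"
    by (rule distr_mvn_linear_involution[OF S'(3)])
       (simp add: matrix_vector_mul_assoc R, simp add: matrix_vector_mul_assoc R, simp only: conj iso)
  have U: "distr (mvn (matrix_inv S)) (mvn (matrix_inv S)) ?U = mvn (matrix_inv S)"
    by (rule distr_mvn_linear_involution[OF pos_def_inv_inv[OF S]])
       (rule matrix_vector_mul_linear, simp only: matrix_vector_mul_assoc R' matrix_vector_mul_lid,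
        simp only: conj S'(4) U_def transpose_transpose involution_isometry_inverse[OF S R iso])
  have meas: "(\<lambda>x. M *v x) \<in> borel_measurable borel" for M :: "real^'d^'d"
    by (intro borel_measurable_continuous_onI matrix_vector_mult_linear_continuous_on)
  have fin: "finite_measure (mvn S)" "finite_measure (mvn (matrix_inv S))"
    using finite_measure_mvn[OF S'(3)] finite_measure_mvn[OF pos_def_inv_inv[OF S]] by auto
  have P: "distr (PiM {..n} (\<lambda>_. mvn S)) (PiM {..n} (\<lambda>_. mvn S)) (\<lambda>X. \<lambda>c\<in>{..n}. ?T (X c))
      = PiM {..n} (\<lambda>_. mvn S)"
    using fin(1) T meas by (intro distr_PiM_invariant) auto
  have \<Phi>: "?\<Phi> \<in> measurable ?D ?D"
    unfolding data_measure_def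
    using meas by (intro measurable_pair) (auto simp: comp_def case_prod_beta
        intro!: measurable_restrict measurable_compose[OF measurable_fst] measurable_compose[OF measurable_snd]
          measurable_compose[OF measurable_component_singleton])
  have D: "distr ?D ?D ?\<Phi> = ?D"
    unfolding data_measure_def
    by (subst pair_measure_distr[symmetric])
       (use meas fin in \<open>auto simp: P U intro!: finite_measure.sigma_finite_measure measurable_restrict
          measurable_compose[OF measurable_component_singleton]\<close>)
  have h: "?h A (?\<Phi> p) = ?h (\<lambda>i. transpose R ** A i ** R) p" for p
  proof -
    obtain X w where p: "p = (X, w)" by (cases p)
    have TU: "?T x \<bullet> ?U w = x \<bullet> w" for x
      unfolding U_def inner_transpose_mult[of "R *v x"]
      by (simp only: matrix_vector_mul_assoc R matrix_vector_mul_lid)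
    have "Zit n A (\<lambda>c\<in>{..n}. ?T (X c)) (?U w) (Suc k) None n
        = Zit n (\<lambda>i. transpose R ** A i ** R) X w (Suc k) None n"
      by (rule Zit_None_equivariant[where T = ?T]) (simp_all add: conj TU)
    then show ?thesis
      using TU[of "X n"] by (simp add: p inner_commute)
  qed
  \<comment> \<open>The trivial class suffices here, since only measurability of the integrand is
    extracted.\<close>
  have coeff: "coefficients (\<lambda>_. True) ?D"
    by (intro coefficients.intro finite_measure_data[OF S]) auto
  have hm: "?h A \<in> borel_measurable ?D"
    using coefficient_fobj(2)[OF S coeff, of "\<lambda>_::unit. A"] by simp
  have "fobj S n k A = integral\<^sup>L (distr ?D ?D ?\<Phi>) (?h A)"
    by (simp only: D fobj_def)
  also have "\<dots> = (\<integral>p. ?h A (?\<Phi> p) \<partial>?D)"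
    by (rule integral_distr[OF \<Phi> hm])
  also have "\<dots> = fobj S n k (\<lambda>i. transpose R ** A i ** R)"
    by (simp only: h fobj_def)
  finally show ?thesis ..
qed

section \<open>Reflections\<close>

definition outer :: "real^'n \<Rightarrow> real^'m \<Rightarrow> real^'m^'n" where
  "outer x y = (\<chi> a b. x $ a * y $ b)"

lemma outer_mult: "outer x y *v z = (y \<bullet> z) *\<^sub>R x"
  by (simp add: outer_def vec_eq_iff matrix_vector_mult_def inner_vec_def sum_distrib_left ac_simps)

lemma inner_outer: "G \<bullet> outer x y = x \<bullet> (G *v y)"
  by (simp add: outer_def inner_vec_def matrix_vector_mult_def sum_distrib_left ac_simps)

lemma outer_conjugate:
  "transpose R ** outer x y ** R = outer (transpose R *v x) (transpose R *v y)" for R :: "real^'d^'d"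
  by (simp only: matrix_eq matrix_vector_mul_assoc[symmetric] outer_mult matrix_vector_mult_scaleR)
     (metis inner_commute inner_transpose_mult)

text \<open>For positive definite \<open>P\<close>, the reflection sending \<open>u\<close> to its
  negative and fixing the vectors orthogonal to \<open>u\<close> in the inner product of
  \<open>P\<close>: a Householder matrix adapted to \<open>P\<close>.\<close>

definition reflection :: "real^'d^'d \<Rightarrow> real^'d \<Rightarrow> real^'d^'d" where
  "reflection P u = mat 1 - (2 / (u \<bullet> (P *v u))) *\<^sub>R outer u (P *v u)"

lemma reflection_apply:
  "reflection P u *v x = x - (2 * ((P *v u) \<bullet> x) / (u \<bullet> (P *v u))) *\<^sub>R u"
  by (simp add: reflection_def matrix_vector_mult_diff_rdistrib scaleR_matrix_vector_assoc[symmetric] outer_mult)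

lemma transpose_reflection_apply:
  "transpose (reflection P u) *v x = x - (2 * (u \<bullet> x) / (u \<bullet> (P *v u))) *\<^sub>R (P *v u)"
proof -
  have "transpose (reflection P u) = mat 1 - (2 / (u \<bullet> (P *v u))) *\<^sub>R outer (P *v u) u"
    by (simp add: reflection_def vec_eq_iff transpose_def outer_def mat_def ac_simps)
  then show ?thesis
    by (simp only: matrix_vector_mult_diff_rdistrib scaleR_matrix_vector_assoc[symmetric] outer_mult)
       simp
qed

lemma reflection_involution:
  assumes "u \<bullet> (P *v u) \<noteq> 0"
  shows "reflection P u ** reflection P u = mat 1"
proof -
  have "reflection P u *v (reflection P u *v x) = x" for x
  proof -
    let ?q = "u \<bullet> (P *v u)" and ?t = "(P *v u) \<bullet> x"
    have "(P *v u) \<bullet> (reflection P u *v x) = - ?t"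
      using assms by (simp add: reflection_apply inner_diff_right inner_commute[of "P *v u" u])
    then have "reflection P u *v (reflection P u *v x)
        = reflection P u *v x - (2 * - ?t / ?q) *\<^sub>R u"
      by (simp only: reflection_apply[of P u "reflection P u *v x"])
    then show ?thesis by (simp add: reflection_apply)
  qed
  then show ?thesis
    by (simp only: matrix_eq matrix_vector_mul_assoc[symmetric] matrix_vector_mul_lid) blast
qed

lemma reflection_isometry:
  assumes P: "transpose P = P" and q: "u \<bullet> (P *v u) \<noteq> 0"
  shows "transpose (reflection P u) ** P ** reflection P u = P"
proof -
  let ?q = "u \<bullet> (P *v u)"
  have "(P *v u) \<bullet> x = u \<bullet> (P *v x)" for x
    using inner_transpose_mult[of u P x] P by simp
  then have sym: "u \<bullet> (P *v x) = (P *v u) \<bullet> x" for x by simp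
  have "transpose (reflection P u) *v (P *v (reflection P u *v x)) = P *v x" for x
  proof -
    let ?t = "(P *v u) \<bullet> x"
    have "P *v (reflection P u *v x) = P *v x - (2 * ?t / ?q) *\<^sub>R (P *v u)"
      by (simp only: reflection_apply matrix_vector_mult_diff_distrib matrix_vector_mult_scaleR)
    moreover have "u \<bullet> (P *v x - (2 * ?t / ?q) *\<^sub>R (P *v u)) = - ?t"
      using q by (simp add: inner_diff_right sym)
    ultimately show ?thesis
      by (simp only: transpose_reflection_apply) simp
  qed
  then show ?thesis
    by (simp only: matrix_eq matrix_vector_mul_assoc[symmetric]) blast
qed

lemma every_vector_eigen_imp_scalar:
  fixes N :: "real^'d^'d"
  assumes "\<And>x. \<exists>c. N *v x = c *\<^sub>R x"
  obtains c where "N = c *\<^sub>R mat 1"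
proof -
  have entry: "N $ a $ b = (N *v axis b 1) $ a" for a b
    by (simp add: matrix_vector_mult_basis column_def)
  have off: "N $ a $ b = 0" if "a \<noteq> b" for a b
    using assms[of "axis b 1"] that by (auto simp: entry axis_def)
  have diag: "N $ a $ a = N $ b $ b" for a b
  proof (cases "a = b")
    case False
    obtain c where c: "N *v (axis a 1 + axis b 1) = c *\<^sub>R (axis a 1 + axis b 1)"
      using assms by blast
    have "(N *v (axis a 1 + axis b 1)) $ i = N $ i $ a + N $ i $ b" for i
      by (simp add: matrix_vector_right_distrib entry)
    then have "N $ i $ a + N $ i $ b = c * (axis a 1 $ i + axis b 1 $ i)" for i
      by (simp add: c)
    from this[of a] this[of b] have "N $ a $ a + N $ a $ b = c" "N $ b $ a + N $ b $ b = c"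
      using False by (simp_all add: axis_def)
    then show ?thesis using off False by simp
  qed simp
  obtain a :: 'd where True by simp
  have "N = N $ a $ a *\<^sub>R mat 1"
    using off diag[of _ a] by (auto simp: vec_eq_iff mat_def)
  then show thesis by (rule that)
qed

text \<open>Every \<open>u\<close> is an eigenvector of \<open>G ** matrix_inv S\<close>. For
  \<open>x\<close> orthogonal to \<open>u\<close> the transposed reflection fixes \<open>x\<close>
  and shifts \<open>u\<close> by a nonzero multiple of \<open>matrix_inv S *v u\<close>, so
  invariance on \<open>outer x u\<close> makes the image of \<open>u\<close> orthogonal to
  \<open>x\<close>.\<close>

lemma reflection_invariant_imp_scalar:
  fixes S G :: "real^'d^'d"
  assumes S: "pos_def_mat S"
    and inv: "\<And>R H. R ** R = mat 1 \<Longrightarrow> transpose R ** matrix_inv S ** R = matrix_inv S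
                \<Longrightarrow> G \<bullet> (transpose R ** H ** R) = G \<bullet> H"
  obtains c where "G = c *\<^sub>R S"
proof -
  note S' = pos_def_mat_inverse[OF S]
  let ?P = "matrix_inv S"
  have "\<exists>c. (G ** ?P) *v u = c *\<^sub>R u" for u
  proof (cases "u = 0")
    case False
    let ?q = "u \<bullet> (?P *v u)" and ?s = "?P *v u"
    let ?R = "reflection ?P u"
    have q: "?q > 0" using pos_def_mat_posD[OF S'(3) False] .
    have perp: "x \<bullet> (G *v ?s) = 0" if x: "u \<bullet> x = 0" for x
    proof -
      have "G \<bullet> (transpose ?R ** outer x u ** ?R) = G \<bullet> outer x u"
        using q pos_def_mat_symD[OF S'(3)]
        by (intro inv reflection_involution reflection_isometry) auto
      then have "(transpose ?R *v x) \<bullet> (G *v (transpose ?R *v u)) = x \<bullet> (G *v u)"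
        by (simp only: outer_conjugate inner_outer)
      moreover have "transpose ?R *v x = x"
        by (simp only: transpose_reflection_apply x) simp
      moreover have "transpose ?R *v u = u - (2 * (u \<bullet> u) / ?q) *\<^sub>R ?s"
        by (rule transpose_reflection_apply)
      ultimately have "(2 * (u \<bullet> u) / ?q) * (x \<bullet> (G *v ?s)) = 0"
        by (simp add: matrix_vector_mult_diff_distrib matrix_vector_mult_scaleR inner_diff_right)
      then show ?thesis using q False by simp
    qed
    \<comment> \<open>The component of the image orthogonal to \<open>u\<close>; taking
      \<open>x = z\<close> in \<open>perp\<close> shows that it has norm zero.\<close>
    define z where "z = G *v ?s - ((u \<bullet> (G *v ?s)) / (u \<bullet> u)) *\<^sub>R u"
    have "u \<bullet> z = 0" using False by (simp add: z_def inner_diff_right)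
    then have "z \<bullet> z = z \<bullet> (G *v ?s)"
      by (subst (2) z_def) (simp add: inner_diff_right inner_commute)
    then have "z = 0" using perp[OF \<open>u \<bullet> z = 0\<close>] by simp
    then show ?thesis by (auto simp: z_def matrix_vector_mul_assoc[symmetric])
  qed simp
  then obtain c where "G ** ?P = c *\<^sub>R mat 1"
    using every_vector_eigen_imp_scalar by metis
  then have "G = c *\<^sub>R S"
    using S'(1) by (metis matrix_mul_assoc matrix_mul_rid matrix_mul_lid scalar_matrix_assoc)
  then show thesis by (rule that)
qed

text \<open>The pairing is the trace of the identity. It converts the derivative along
  \<open>matrix_inv S\<close> into the coefficient of \<open>S\<close> in the gradient.\<close>

lemma inner_inverse:
  fixes S :: "real^'d^'d"
  assumes S: "pos_def_mat S"
  shows "S \<bullet> matrix_inv S = CARD('d)"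
proof -
  note S' = pos_def_mat_inverse[OF S]
  have "S \<bullet> matrix_inv S = (\<Sum>a\<in>UNIV. (S ** transpose (matrix_inv S)) $ a $ a)"
    by (simp add: inner_vec_def matrix_matrix_mult_def transpose_def)
  then show ?thesis
    by (simp add: pos_def_mat_symD[OF S'(3)] S'(2) mat_def)
qed

section \<open>Gradients on scalar configurations\<close>

text \<open>As \<open>frob_grad\<close> is a Hilbert choice, a representing matrix must be exhibited
  first: f is differentiable as a separable integral, and the values of the derivative on
  \<open>Basis\<close> are the coordinates of its Riesz vector.\<close>

lemma fobj_has_derivative:
  fixes S :: "real^'d^'d"
  assumes S: "pos_def_mat S"
  shows "((\<lambda>B. fobj S n k (A(i := B)))
      has_derivative (\<lambda>H. frob_grad (\<lambda>B. fobj S n k (A(i := B))) B0 \<bullet> H)) (at B0)"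
proof -
  let ?g = "\<lambda>B. fobj S n k (A(i := B))"
  have coeff: "coefficients (\<lambda>e :: real^'d^'d \<Rightarrow> real. \<forall>B. e differentiable at B) (data_measure S n)"
    by (rule coefficients.intro)
       (auto intro!: differentiable_add differentiable_mult finite_measure_data[OF S])
  have "(\<lambda>B. (A(i := B)) j $ a $ b) differentiable at B" for j a b B
  proof (cases "j = i")
    case True
    have "bounded_linear (\<lambda>B :: real^'d^'d. B $ a $ b)"
      by (intro bounded_linear_compose[OF bounded_linear_vec_nth] bounded_linear_vec_nth)
    then show ?thesis using True by (auto intro: bounded_linear_imp_differentiable)
  qed simp
  then have "?g differentiable at B0"
    using coefficient_fobj(1)[OF S coeff, of "\<lambda>B. A(i := B)" k] by blast
  then obtain D where D: "(?g has_derivative D) (at B0)"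
    unfolding differentiable_def by blast
  have "D = (\<lambda>H. (\<Sum>b\<in>Basis. D b *\<^sub>R b) \<bullet> H)"
  proof
    fix H
    have "D H = D (\<Sum>b\<in>Basis. (H \<bullet> b) *\<^sub>R b)" by (simp add: euclidean_representation)
    also have "\<dots> = (\<Sum>b\<in>Basis. (H \<bullet> b) * D b)"
      using has_derivative_linear[OF D] by (simp add: linear_sum linear_scale)
    also have "\<dots> = (\<Sum>b\<in>Basis. D b *\<^sub>R b) \<bullet> H"
      by (simp add: inner_sum_left inner_commute[of H] mult.commute)
    finally show "D H = (\<Sum>b\<in>Basis. D b *\<^sub>R b) \<bullet> H" .
  qed
  with D have "\<exists>G. (?g has_derivative (\<lambda>H. G \<bullet> H)) (at B0)" by metis
  then show ?thesis unfolding frob_grad_def by (rule someI_ex)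
qed

text \<open>Invariance of f and the chain rule make \<open>G\<close> invariant, so
  \<open>G = c *\<^sub>R S\<close>, and pairing with \<open>matrix_inv S\<close> recovers
  \<open>c\<close>. In particular \<open>G\<close> is symmetric, so it is also the gradient within
  the symmetric matrices.\<close>

lemma norm_frob_grad_scalar:
  fixes S G :: "real^'d^'d" and a :: "nat \<Rightarrow> real"
  assumes S: "pos_def_mat S"
    and A_def: "A = (\<lambda>j. a j *\<^sub>R matrix_inv S)"
    and G_def: "G = frob_grad (\<lambda>B. fobj S n k (A(i := B))) (A i)"
  shows "(norm G)\<^sup>2 = (G \<bullet> matrix_inv S)\<^sup>2 * ((norm S)\<^sup>2 / (real CARD('d))\<^sup>2)"
proof -
  let ?g = "\<lambda>B. fobj S n k (A(i := B))"
  have D: "(?g has_derivative (\<lambda>H. G \<bullet> H)) (at (A i))"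
    unfolding G_def by (rule fobj_has_derivative[OF S])
  have inv: "G \<bullet> (transpose R ** H ** R) = G \<bullet> H"
    if R: "R ** R = mat 1" and iso: "transpose R ** matrix_inv S ** R = matrix_inv S" for R H
  proof -
    let ?c = "\<lambda>B. transpose R ** B ** R"
    have lin: "bounded_linear ?c"
      by (intro linear_linear[THEN iffD2] linearI)
         (simp_all add: vec_eq_iff matrix_matrix_mult_def sum.distrib sum_distrib_left algebra_simps)
    have fix_A: "?c (A j) = A j" for j
      using iso by (simp add: A_def matrix_scalar_ac scalar_matrix_assoc[symmetric])
    \<comment> \<open>Conjugating the whole sequence alters only slot \<open>i\<close>, every other
      entry being fixed; hence the symmetry acts on one matrix at a time.\<close>
    have "?g (?c B) = ?g B" for B
    proof -
      have "A(i := ?c B) = (\<lambda>j. ?c ((A(i := B)) j))"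
        by (auto simp: fix_A)
      then show ?thesis using fobj_conjugate[OF S R iso, of n k "A(i := B)"] by simp
    qed
    moreover have "((\<lambda>B. ?g (?c B)) has_derivative (\<lambda>H. G \<bullet> ?c H)) (at (A i))"
      by (rule has_derivative_compose[OF bounded_linear_imp_has_derivative[OF lin]])
         (simp only: fix_A D)
    ultimately have "(?g has_derivative (\<lambda>H. G \<bullet> ?c H)) (at (A i))" by simp
    from has_derivative_unique[OF this D] show ?thesis by metis
  qed
  obtain c where c: "G = c *\<^sub>R S"
    using reflection_invariant_imp_scalar[OF S inv] by blast
  have "G \<bullet> matrix_inv S = c * CARD('d)"
    by (simp add: c inner_inverse[OF S])
  moreover have "(norm G)\<^sup>2 = c\<^sup>2 * (norm S)\<^sup>2"
    by (simp add: c power_mult_distrib)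
  ultimately show ?thesis
    by (simp add: power_mult_distrib)
qed

section \<open>Small partial derivatives by penalised minimisation\<close>

lemma fobj_nonneg: "fobj S n k A \<ge> 0"
  by (simp add: fobj_def)

text \<open>Tychonoff's theorem, in the product topology in which the objective is continuous as a
  function of the whole sequence of scalars.\<close>

lemma compact_box_fun: "compact {a :: nat \<Rightarrow> real. \<forall>i. a i \<in> {l i .. u i}}"
proof -
  have "compactin (product_topology (\<lambda>_. euclidean) UNIV) (\<Pi>\<^sub>E i\<in>UNIV. {l i .. u i :: real})"
    by (subst compactin_PiE) auto
  moreover have "(\<Pi>\<^sub>E i\<in>UNIV. {l i .. u i}) = {a. \<forall>i. a i \<in> {l i .. u i}}"
    by (auto simp: PiE_iff)
  ultimately show ?thesis by (simp add: euclidean_product_topology)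
qed

text \<open>The penalty \<open>\<epsilon> |a|\<^sup>2\<close> makes the objective coercive; at a minimiser it is at most
  the value at \<open>0\<close>, so the derivatives \<open>- 2 \<epsilon> a\<^sub>i\<close> of the unpenalised objective are of order
  \<open>\<surd>\<epsilon>\<close>.\<close>
lemma penalised_critical_point:
  fixes F :: "(nat \<Rightarrow> real) \<Rightarrow> real"
  assumes cont: "continuous_on UNIV F" and nonneg: "\<And>a. F a \<ge> 0"
    and deriv: "\<And>a i. i \<le> k \<Longrightarrow> ((\<lambda>t. F (a(i := t))) has_real_derivative F' i a) (at (a i))"
    and \<epsilon>: "\<epsilon> > 0"
  obtains a where "\<And>i. i \<le> k \<Longrightarrow> (F' i a)\<^sup>2 \<le> 4 * \<epsilon> * F (\<lambda>_. 0)"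
proof -
  \<comment> \<open>Comparison with the origin bounds each \<open>\<bar>a i\<bar>\<close> by the
    square root. Adding 1 makes the minimiser interior in the coordinates up to \<open>k\<close>,
    while \<open>u\<close> freezes all later ones at 0.\<close>
  define r where "r = sqrt (F (\<lambda>_. 0) / \<epsilon>) + 1"
  define u where "u = (\<lambda>i. if i \<le> k then r else 0)"
  define K where "K = {a :: nat \<Rightarrow> real. \<forall>i. a i \<in> {- u i .. u i}}"
  define h where "h = (\<lambda>a. F a + \<epsilon> * (\<Sum>i\<le>k. (a i)\<^sup>2))"
  have r: "r > 0" using nonneg[of "\<lambda>_. 0"] \<epsilon> by (simp add: r_def add_nonneg_pos)
  have zero: "(\<lambda>_. 0) \<in> K" using r by (auto simp: K_def u_def)
  have "continuous_on K h"
    unfolding h_def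
    by (intro continuous_intros continuous_on_subset[OF cont]
        continuous_on_subset[OF continuous_on_product_coordinates]) auto
  moreover have "compact K" unfolding K_def by (rule compact_box_fun)
  ultimately have "\<exists>a\<in>K. \<forall>b\<in>K. h a \<le> h b"
    using zero by (intro continuous_attains_inf) auto
  then obtain a where a: "a \<in> K" "\<And>b. b \<in> K \<Longrightarrow> h a \<le> h b" by blast
  have le: "\<epsilon> * (a i)\<^sup>2 \<le> F (\<lambda>_. 0)" if "i \<le> k" for i
  proof -
    have "\<epsilon> * (a i)\<^sup>2 \<le> \<epsilon> * (\<Sum>i\<le>k. (a i)\<^sup>2)"
      using \<epsilon> that by (intro mult_left_mono member_le_sum) auto
    also have "\<dots> \<le> h a" using nonneg[of a] by (simp add: h_def)
    also have "\<dots> \<le> h (\<lambda>_. 0)" by (rule a(2)[OF zero])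
    finally show ?thesis by (simp add: h_def)
  qed
  show thesis
  proof (rule that)
    fix i assume i: "i \<le> k"
    have "(a i)\<^sup>2 \<le> F (\<lambda>_. 0) / \<epsilon>" using le[OF i] \<epsilon> by (simp add: field_simps)
    then have "\<bar>a i\<bar> \<le> sqrt (F (\<lambda>_. 0) / \<epsilon>)" by (simp add: real_le_rsqrt)
    then have ai: "\<bar>a i\<bar> < r" by (simp add: r_def)
    have "((\<lambda>t. F (a(i := t)) + \<epsilon> * (t\<^sup>2 + (\<Sum>j\<in>{..k} - {i}. (a j)\<^sup>2)))
        has_real_derivative F' i a + \<epsilon> * (2 * a i)) (at (a i))"
      by (auto intro!: derivative_eq_intros deriv i)
    also have "(\<lambda>t. F (a(i := t)) + \<epsilon> * (t\<^sup>2 + (\<Sum>j\<in>{..k} - {i}. (a j)\<^sup>2))) = (\<lambda>t. h (a(i := t)))"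
      using i by (auto simp: h_def sum.remove[of "{..k}" i] intro!: sum.cong)
    finally have "((\<lambda>t. h (a(i := t))) has_real_derivative F' i a + \<epsilon> * (2 * a i)) (at (a i))" .
    moreover have "\<forall>t. \<bar>a i - t\<bar> < r - \<bar>a i\<bar> \<longrightarrow> h (a(i := a i)) \<le> h (a(i := t))"
    proof (intro allI impI)
      fix t assume "\<bar>a i - t\<bar> < r - \<bar>a i\<bar>"
      then have "\<bar>t\<bar> \<le> r" by linarith
      then have "t \<in> {- u i .. u i}" using i by (auto simp: u_def)
      then have "a(i := t) \<in> K" using a(1) by (simp add: K_def)
      then show "h (a(i := a i)) \<le> h (a(i := t))" using a(2) by simp
    qed
    ultimately have "F' i a + \<epsilon> * (2 * a i) = 0"
      using ai by (intro DERIV_local_min[where d = "r - \<bar>a i\<bar>"]) auto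
    then have "F' i a = - (2 * \<epsilon> * a i)" by simp
    then have "(F' i a)\<^sup>2 = 4 * \<epsilon> * (\<epsilon> * (a i)\<^sup>2)" by (simp add: power2_eq_square)
    also have "\<dots> \<le> 4 * \<epsilon> * F (\<lambda>_. 0)" using \<epsilon> le[OF i] by (intro mult_left_mono) auto
    finally show "(F' i a)\<^sup>2 \<le> 4 * \<epsilon> * F (\<lambda>_. 0)" .
  qed
qed

theorem theorem3:
  fixes S :: "real^'d^'d" and n k :: nat
  assumes "n \<ge> 1" and "pos_def_mat S"
  shows "(INF A \<in> {A. \<forall>i\<le>k. \<exists>a::real. A i = a *\<^sub>R matrix_inv S}.
            \<Sum>i\<le>k. (norm (frob_grad (\<lambda>B. fobj S n k (A(i := B))) (A i)))\<^sup>2) = 0"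
proof -
  note S = \<open>pos_def_mat S\<close>
  let ?P = "matrix_inv S"
  let ?D = "{A. \<forall>i\<le>k. \<exists>a::real. A i = a *\<^sub>R ?P}"
  let ?grad = "\<lambda>A i. frob_grad (\<lambda>B. fobj S n k (A(i := B))) (A i)"
  let ?E = "\<lambda>A. \<Sum>i\<le>k. (norm (?grad A i))\<^sup>2"
  \<comment> \<open>All indices, also those above \<open>k\<close>, receive multiples of
    \<open>?P\<close>, because the symmetry argument conjugates the entire sequence.\<close>
  define lift where "lift = (\<lambda>a::nat \<Rightarrow> real. \<lambda>j. a j *\<^sub>R ?P)"
  define F where "F = (\<lambda>a. fobj S n k (lift a))"
  have lift_upd: "lift (a(i := t)) = (lift a)(i := t *\<^sub>R ?P)" for a i t
    by (auto simp: lift_def)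
  have coeff: "coefficients (continuous_on (UNIV :: (nat \<Rightarrow> real) set)) (data_measure S n)"
    using finite_measure_data[OF S]
    by (intro coefficients.intro) (auto intro!: continuous_on_add continuous_on_mult)
  have "continuous_on (UNIV :: (nat \<Rightarrow> real) set) (\<lambda>a. lift a j $ x $ y)" for j x y
    unfolding lift_def by (simp add: continuous_on_mult_right)
  then have cont: "continuous_on UNIV F"
    unfolding F_def by (rule coefficient_fobj(1)[OF S coeff, where A = lift])
  have deriv: "((\<lambda>t. F (a(i := t))) has_real_derivative ?grad (lift a) i \<bullet> ?P) (at (a i))" for a i
  proof -
    have "((\<lambda>t. t *\<^sub>R ?P) has_derivative (\<lambda>t. t *\<^sub>R ?P)) (at (a i))"
      by (intro derivative_intros)
    moreover have "((\<lambda>B. fobj S n k ((lift a)(i := B))) has_derivative (\<lambda>H. ?grad (lift a) i \<bullet> H))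
        (at (a i *\<^sub>R ?P))"
      using fobj_has_derivative[OF S, of n k "lift a" i "a i *\<^sub>R ?P"] by (simp add: lift_def)
    ultimately have "((\<lambda>t. fobj S n k ((lift a)(i := t *\<^sub>R ?P)))
        has_derivative (\<lambda>t. ?grad (lift a) i \<bullet> (t *\<^sub>R ?P))) (at (a i))"
      by (rule has_derivative_compose)
    moreover have "(\<lambda>t. ?grad (lift a) i \<bullet> (t *\<^sub>R ?P)) = (*) (?grad (lift a) i \<bullet> ?P)"
      by (simp add: fun_eq_iff mult.commute)
    ultimately show ?thesis
      by (simp only: F_def lift_upd has_field_derivative_def)
  qed
  have F_nonneg: "F a \<ge> 0" for a by (simp add: F_def fobj_nonneg)
  have nonneg: "0 \<le> ?E A" for A by (intro sum_nonneg) simp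
  define c where "c = (norm S)\<^sup>2 / (real CARD('d))\<^sup>2"
  have "(INF A \<in> ?D. ?E A) \<le> 0 + e" if "e > 0" for e
  proof -
    \<comment> \<open>The sum of squared gradients is at most \<open>\<epsilon> * m\<close>;
      dividing \<open>e\<close> by \<open>m + 1\<close> instead of \<open>m\<close> covers the case
      \<open>m = 0\<close>.\<close>
    define m where "m = (real k + 1) * (4 * F (\<lambda>_. 0) * c)"
    have m: "m \<ge> 0" by (simp add: m_def c_def F_nonneg)
    define \<epsilon> where "\<epsilon> = e / (m + 1)"
    have "\<epsilon> > 0" using that m by (simp add: \<epsilon>_def)
    from penalised_critical_point[OF cont F_nonneg deriv this, of k]
    obtain a where a: "\<And>i. i \<le> k \<Longrightarrow> (?grad (lift a) i \<bullet> ?P)\<^sup>2 \<le> 4 * \<epsilon> * F (\<lambda>_. 0)"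
      by blast
    have "?E (lift a) = (\<Sum>i\<le>k. (?grad (lift a) i \<bullet> ?P)\<^sup>2 * c)"
      unfolding c_def
      by (rule sum.cong[OF refl], rule norm_frob_grad_scalar[OF S _ refl])
         (simp only: lift_def)
    also have "\<dots> \<le> (\<Sum>i\<le>k. 4 * \<epsilon> * F (\<lambda>_. 0) * c)"
      using a by (intro sum_mono mult_right_mono) (auto simp: c_def)
    also have "\<dots> = \<epsilon> * m" by (simp add: m_def algebra_simps)
    also have "\<dots> \<le> e" using that m by (simp add: \<epsilon>_def field_simps)
    finally have "?E (lift a) \<le> e" .
    moreover have "lift a \<in> ?D" by (auto simp: lift_def)
    \<comment> \<open>An infimum of reals is controlled only on a set bounded below; nonnegativity
      supplies this.\<close>
    moreover have "bdd_below (?E ` ?D)" by (rule bdd_belowI2[OF nonneg])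
    ultimately have "(INF A \<in> ?D. ?E A) \<le> e" by (intro cINF_lower2)
    then show ?thesis by (simp only: add_0)
  qed
  then have "(INF A \<in> ?D. ?E A) \<le> 0" by (rule field_le_epsilon)
  moreover have "0 \<le> (INF A \<in> ?D. ?E A)"
  proof (rule cINF_greatest)
    have "(\<lambda>_. 0) \<in> ?D" by (auto intro: exI[of _ 0])
    then show "?D \<noteq> {}" by (rule ex_in_conv[THEN iffD1, OF exI])
  qed (rule nonneg)
  ultimately show ?thesis by (rule antisym)
qed

end
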